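(* Let $n$ be a positive integer, and let $A$ and $B$ denote independent samples from a (common) probability distribution over subsets of $[n]$. Assume that for all $i \in [n]$, $\Pr[i \in A] \leq 0.01$. Then $H(A \cup B) \geq 1.26\, H(A)$.
   Context: Here $[n] = \{1,\dots,n\}$. For a random variable $Y$ taking values in a finite set, $H(Y) = -\sum_y \Pr[Y=y]\log \Pr[Y=y]$ denotes its Shannon entropy, with $\log$ the base 2 logarithm and the convention $0\log 0 = 0$. The probability distribution over subsets of $[n]$ is arbitrary (not necessarily uniform on its support). *)

theory Defs
  imports "HOL-Probability.Probability"
begin

text \<open>For a random variable with values in a finite set, the library's entropy (a negated
  Kullback-Leibler divergence with respect to counting measure) is the Shannon entropy; values of
  probability zero contribute nothing.\<close>

lemma entropy_count_space_finite:
  assumes "prob_space M" and "finite S" and X: "X \<in> M \<rightarrow>\<^sub>M count_space S"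
  shows "prob_space.entropy M 2 (count_space S) X =
    - (\<Sum>s\<in>S. measure M {\<omega> \<in> space M. X \<omega> = s} * log 2 (measure M {\<omega> \<in> space M. X \<omega> = s}))"
proof -
  interpret prob_space M by fact
  interpret information_space M 2 by standard simp
  let ?p = "\<lambda>s. measure M {\<omega> \<in> space M. X \<omega> = s}"
  have "distributed M (count_space S) X ?p"
    unfolding distributed_def
  proof (intro conjI measure_eqI)
    fix T assume "T \<in> sets (distr M (count_space S) X)"
    then have T: "T \<subseteq> S" by simp
    then have fin: "finite T" using \<open>finite S\<close> finite_subset by blast
    have meas: "{\<omega> \<in> space M. X \<omega> = s} \<in> sets M" if "s \<in> S" for s
    proof -
      have "{\<omega> \<in> space M. X \<omega> = s} = X -` {s} \<inter> space M" by auto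
      then show ?thesis using measurable_sets[OF X, of "{s}"] that by simp
    qed
    have "X -` T \<inter> space M = (\<Union>s\<in>T. {\<omega> \<in> space M. X \<omega> = s})" by auto
    then have "emeasure M (X -` T \<inter> space M) = (\<Sum>s\<in>T. emeasure M {\<omega> \<in> space M. X \<omega> = s})"
      using T fin meas
      by (auto simp: disjoint_family_on_def intro!: sum_emeasure[symmetric])
    also have "\<dots> = (\<Sum>s\<in>T. ennreal (?p s))"
      by (simp add: emeasure_eq_measure)
    also have "\<dots> = emeasure (density (count_space S) (\<lambda>s. ennreal (?p s))) T"
    proof -
      have "emeasure (density (count_space S) (\<lambda>s. ennreal (?p s))) T
          = (\<integral>\<^sup>+ s. ennreal (?p s) * indicator T s \<partial>count_space S)"
        using T by (simp add: emeasure_density)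
      also have "\<dots> = (\<Sum>s\<in>S. ennreal (?p s) * indicator T s)"
        using \<open>finite S\<close> by (simp add: nn_integral_count_space_finite)
      also have "\<dots> = (\<Sum>s\<in>T. ennreal (?p s))"
        using \<open>finite S\<close> T by (intro sum.mono_neutral_cong_right) (auto simp: indicator_def)
      finally show ?thesis by simp
    qed
    finally show "emeasure (distr M (count_space S) X) T
        = emeasure (density (count_space S) (\<lambda>s. ennreal (?p s))) T"
      using X T by (simp add: emeasure_distr)
  qed (use X in auto)
  then show ?thesis
    using \<open>finite S\<close>
    by (subst entropy_distr) (auto simp: lebesgue_integral_count_space_finite)
qed

end

theory Submission
  imports Defs
begin

text \<open>Gilmer's argument. Reveal the elements of \<open>[n]\<close> one at a time: by the chain rule and
  concavity of the binary entropy \<open>h\<close>, it suffices to show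
  \<open>E h(p + q - p q) \<ge> 1.26 E h(p)\<close> for i.i.d. \<open>p, q\<close> in \<open>[0,1]\<close> with mean at most \<open>0.01\<close>. If
  \<open>p, q \<le> 0.1\<close>, then \<open>h(p + q - p q) \<ge> 0.7 (h p + h q)\<close>; if only \<open>p \<le> 0.1\<close>, then
  concavity gives \<open>h(p + q - p q) \<ge> (1 - p) h q \<ge> 0.9 h q\<close>. By Markov's inequality
  \<open>p \<le> 0.1\<close> has probability at least \<open>0.9\<close>, and \<open>2 * 0.7 * 0.9 = 1.26\<close>.\<close>

section \<open>Binary entropy in homogeneous form\<close>

definition eta :: "real \<Rightarrow> real" where
  "eta x = - (x * ln x)"

text \<open>The homogeneous form \<open>binent u v = (u + v) h(v / (u + v))\<close> of the binary entropy (in nats)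
  avoids conditioning on null events; concavity of \<open>h\<close> becomes superadditivity.\<close>

definition binent :: "real \<Rightarrow> real \<Rightarrow> real" where
  "binent u v = eta u + eta v - eta (u + v)"

lemma eta_0_1 [simp]: "eta 0 = 0" "eta 1 = 0"
  by (simp_all add: eta_def)

lemma eta_mult:
  assumes "x \<ge> 0" "y \<ge> 0"
  shows "eta (x * y) = x * eta y + y * eta x"
  using assms by (cases "x = 0 \<or> y = 0") (auto simp: eta_def ln_mult algebra_simps)

lemma binent_0 [simp]: "binent 0 v = 0" "binent u 0 = 0"
  by (simp_all add: binent_def)

lemma binent_commute: "binent u v = binent v u"
  by (simp add: binent_def add.commute)

text \<open>By the product rule for \<open>eta\<close>, the terms in \<open>eta c\<close> have
  coefficients \<open>u\<close>, \<open>v\<close> and \<open>- (u + v)\<close>, so they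
  cancel.\<close>

lemma binent_scale:
  assumes "c \<ge> 0" "u \<ge> 0" "v \<ge> 0"
  shows "binent (c * u) (c * v) = c * binent u v"
proof -
  have "eta (c * u + c * v) = c * eta (u + v) + (u + v) * eta c"
    using eta_mult[of c "u + v"] assms by (simp add: distrib_left)
  then show ?thesis
    using assms by (simp add: binent_def eta_mult algebra_simps)
qed

text \<open>Gibbs' inequality, from \<open>ln z \<le> z - 1\<close> at
  \<open>z = s * (u + v) / u\<close> and \<open>z = t * (u + v) / v\<close>. The bound is linear in
  \<open>u\<close> and \<open>v\<close>, so bounds for the same \<open>s\<close> and
  \<open>t\<close> can be added.\<close>

lemma gibbs_binent:
  assumes "u \<ge> 0" "v \<ge> 0" "s > 0" "t > 0" "s + t = 1"
  shows "binent u v \<le> - u * ln s - v * ln t"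
proof (cases "u = 0 \<or> v = 0")
  case True
  have "ln s \<le> 0" "ln t \<le> 0" using assms by simp_all
  with True assms show ?thesis
    by (auto simp: mult_nonneg_nonpos)
next
  case False
  with assms have pos: "u > 0" "v > 0" by auto
  have u: "u * (ln s + ln (u + v) - ln u) \<le> s * (u + v) - u"
  proof -
    have "ln s + ln (u + v) - ln u = ln (s * (u + v) / u)"
      using pos assms by (simp add: ln_div ln_mult)
    also have "\<dots> \<le> s * (u + v) / u - 1"
      using pos assms by (intro ln_le_minus_one) simp
    finally have "u * (ln s + ln (u + v) - ln u) \<le> u * (s * (u + v) / u - 1)"
      using pos by simp
    then show ?thesis using pos by (simp add: right_diff_distrib)
  qed
  have v: "v * (ln t + ln (u + v) - ln v) \<le> t * (u + v) - v"
  proof -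
    have "ln t + ln (u + v) - ln v = ln (t * (u + v) / v)"
      using pos assms by (simp add: ln_div ln_mult)
    also have "\<dots> \<le> t * (u + v) / v - 1"
      using pos assms by (intro ln_le_minus_one) simp
    finally have "v * (ln t + ln (u + v) - ln v) \<le> v * (t * (u + v) / v - 1)"
      using pos by simp
    then show ?thesis using pos by (simp add: right_diff_distrib)
  qed
  have "s * (u + v) + t * (u + v) = u + v"
    using assms(5) by (simp flip: distrib_right)
  with u v show ?thesis
    by (simp add: binent_def eta_def algebra_simps)
qed

lemma binent_eq_cross:
  assumes "u > 0" "v > 0"
  shows "binent u v = - u * ln (u / (u + v)) - v * ln (v / (u + v))"
  using assms by (simp add: binent_def eta_def ln_div algebra_simps)

lemma binent_nonneg:
  assumes "u \<ge> 0" "v \<ge> 0"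
  shows "binent u v \<ge> 0"
proof (cases "u = 0 \<or> v = 0")
  case False
  with assms have "u > 0" "v > 0" by auto
  then have "- u * ln (u / (u + v)) \<ge> 0" "- v * ln (v / (u + v)) \<ge> 0"
    by (simp_all add: mult_nonneg_nonpos)
  then show ?thesis
    using binent_eq_cross[of u v] \<open>u > 0\<close> \<open>v > 0\<close> by linarith
qed auto

text \<open>Both summands are bounded by cross entropies against the same \<open>s\<close> and
  \<open>t\<close>, the normalised totals; these bounds add up to the equality case of Gibbs'
  inequality.\<close>

lemma binent_superadditive:
  assumes "u \<ge> 0" "v \<ge> 0" "u' \<ge> 0" "v' \<ge> 0"
  shows "binent (u + u') (v + v') \<ge> binent u v + binent u' v'"
proof (cases "u + u' = 0 \<or> v + v' = 0")
  case True
  then have "u = 0 \<and> u' = 0 \<or> v = 0 \<and> v' = 0" using assms by auto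
  then show ?thesis by auto
next
  case False
  define U V where "U = u + u'" and "V = v + v'"
  have pos: "U > 0" "V > 0" using False assms by (auto simp: U_def V_def)
  define s t where "s = U / (U + V)" and "t = V / (U + V)"
  have st: "s > 0" "t > 0" "s + t = 1"
    using pos by (auto simp: s_def t_def simp flip: add_divide_distrib)
  have "binent u v + binent u' v' \<le> - U * ln s - V * ln t"
    using gibbs_binent[OF assms(1,2) st] gibbs_binent[OF assms(3,4) st]
    by (simp add: U_def V_def algebra_simps)
  also have "\<dots> = binent U V"
    using binent_eq_cross[OF pos] by (simp add: s_def t_def)
  finally show ?thesis by (simp add: U_def V_def)
qed

lemma binent_sum:
  assumes "\<And>i. i \<in> I \<Longrightarrow> f i \<ge> 0" "\<And>i. i \<in> I \<Longrightarrow> g i \<ge> 0"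
  shows "(\<Sum>i\<in>I. binent (f i) (g i)) \<le> binent (sum f I) (sum g I)"
  using assms
proof (induction I rule: infinite_finite_induct)
  case (insert i I)
  have "binent (f i) (g i) + binent (sum f I) (sum g I) \<le> binent (f i + sum f I) (g i + sum g I)"
    using insert.prems by (intro binent_superadditive sum_nonneg) auto
  with insert.IH insert.prems insert.hyps show ?case by fastforce
qed auto

section \<open>Binary entropy of a union at small probabilities\<close>

text \<open>\<open>h\<close> is symmetric and concave, and \<open>s\<close> is a convex combination
  of \<open>r\<close> and \<open>1 - r\<close>, with weight \<open>t\<close> on
  \<open>r\<close>.\<close>

lemma binent_mono:
  assumes "0 \<le> r" "r < 1/2" "r \<le> s" "s \<le> 1 - r"
  shows "binent (1 - r) r \<le> binent (1 - s) s"
proof -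
  define t where "t = (1 - r - s) / (1 - 2 * r)"
  have t: "0 \<le> t" "t \<le> 1"
    using assms by (auto simp: t_def field_simps)
  have "t * (1 - 2 * r) = 1 - r - s"
    using assms by (simp add: t_def)
  then have s: "s = t * r + (1 - t) * (1 - r)" "1 - s = t * (1 - r) + (1 - t) * r"
    by (auto simp: algebra_simps)
  have "binent (t * (1 - r)) (t * r) + binent ((1 - t) * r) ((1 - t) * (1 - r))
      \<le> binent (t * (1 - r) + (1 - t) * r) (t * r + (1 - t) * (1 - r))"
    using t assms by (intro binent_superadditive) auto
  moreover have "binent (t * (1 - r)) (t * r) = t * binent (1 - r) r"
    using t assms by (intro binent_scale) auto
  moreover have "binent ((1 - t) * r) ((1 - t) * (1 - r)) = (1 - t) * binent (1 - r) r"
    using t assms by (subst binent_scale) (auto simp: binent_commute)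
  ultimately show ?thesis
    unfolding s(1)[symmetric] s(2)[symmetric] by (simp add: left_diff_distrib)
qed

text \<open>This is the case \<open>p = q = m\<close> of the bound on \<open>h(p + q - p q)\<close>,
  to which the general case is reduced by averaging.\<close>

lemma binent_square:
  fixes m :: real
  assumes "0 \<le> m" "m \<le> 1/10"
  shows "7/5 * binent (1 - m) m \<le> binent ((1 - m)\<^sup>2) (1 - (1 - m)\<^sup>2)"
proof (cases "m = 0")
  case False
  with assms have m: "m > 0" by simp
  define x where "x = 1 - m"
  have x: "9/10 \<le> x" "x < 1" using assms m by (auto simp: x_def)
  \<comment> \<open>The factorisation splits \<open>ln (1 - x\<^sup>2)\<close> into
    \<open>ln m + ln (1 + x)\<close>, which isolates the dominant term in
    \<open>- ln m\<close>.\<close>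
  have "1 - x\<^sup>2 = m * (1 + x)"
    by (simp add: x_def power2_eq_square algebra_simps)
  then have eq: "binent (x\<^sup>2) (1 - x\<^sup>2) - 7/5 * binent x m
      = (2 * x\<^sup>2 - 7/5 * x) * (- ln x) + m * ((x - 2/5) * (- ln m) - (1 + x) * ln (1 + x))"
    using m x by (simp add: binent_def eta_def ln_mult ln_realpow x_def[symmetric])
      (simp add: x_def field_simps power2_eq_square)
  have "36/100 * m \<le> (2 * x\<^sup>2 - 7/5 * x) * (- ln x)"
  proof (intro mult_mono)
    \<comment> \<open>The product expands to
      \<open>2 * x\<^sup>2 - 7/5 * x - 36/100\<close>.\<close>
    have "0 \<le> (x - 9/10) * (2 * x + 2/5)" using x by simp
    then show "36/100 \<le> 2 * x\<^sup>2 - 7/5 * x"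
      by (simp add: power2_eq_square algebra_simps)
    then show "0 \<le> 2 * x\<^sup>2 - 7/5 * x" by simp
    show "m \<le> - ln x" using ln_le_minus_one[of x] x by (simp add: x_def)
  qed (use m in simp)
  moreover have "1/2 * (3 * ln 2) \<le> (x - 2/5) * (- ln m)"
  proof (intro mult_mono)
    \<comment> \<open>Relaxing \<open>1/10\<close> to \<open>1/8\<close>, a power of 2, leaves
      \<open>ln 2\<close> as the only logarithm to estimate.\<close>
    have "ln m \<le> ln (1/8)" using assms m by simp
    also have "ln (1/8 :: real) = - (3 * ln 2)"
      using ln_realpow[of "2::real" 3] by (simp add: ln_div)
    finally show "3 * ln 2 \<le> - ln m" by simp
  qed (use x in auto)
  moreover have "(1 + x) * ln (1 + x) \<le> 2 * ln 2"
    using x by (intro mult_mono) auto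
  ultimately have "m * (36/100 + 1/2 * (3 * ln 2) - 2 * ln 2)
      \<le> binent (x\<^sup>2) (1 - x\<^sup>2) - 7/5 * binent x m"
    unfolding eq using m
      mult_left_mono[of "1/2 * (3 * ln 2) - 2 * ln 2" "(x - 2/5) * (- ln m) - (1 + x) * ln (1 + x)" m]
    by (simp add: algebra_simps)
  \<comment> \<open>The bracket is \<open>36/100 - ln 2 / 2\<close>, which is positive because
    \<open>ln 2 \<le> 25/36 < 72/100\<close>.\<close>
  moreover have "0 \<le> m * (36/100 + 1/2 * (3 * ln 2) - 2 * ln (2::real))"
    using m ln2_le_25_over_36 by (intro mult_nonneg_nonneg) auto
  ultimately show ?thesis by (simp add: x_def)
qed simp

text \<open>Both probabilities are replaced by their mean \<open>m\<close>. Concavity gives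
  \<open>h p + h q \<le> 2 * h m\<close>, and by AM-GM the union probability \<open>r\<close> of two
  events of probability \<open>m\<close> is at most \<open>s\<close>, in the range where
  \<open>h s\<close> dominates \<open>h r\<close>.\<close>

lemma binent_or:
  fixes p q :: real
  assumes "0 \<le> p" "p \<le> 1/10" "0 \<le> q" "q \<le> 1/10"
  shows "7/10 * (binent (1 - p) p + binent (1 - q) q)
    \<le> binent ((1 - p) * (1 - q)) (1 - (1 - p) * (1 - q))"
proof -
  define m where "m = (p + q) / 2"
  define r where "r = 1 - (1 - m)\<^sup>2"
  define s where "s = 1 - (1 - p) * (1 - q)"
  have m: "0 \<le> m" "m \<le> 1/10" using assms by (auto simp: m_def)
  have "2 * (1 - m) = (1 - p) + (1 - q)" "2 * m = p + q"
    by (simp_all add: m_def field_simps)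
  moreover have "binent (1 - p) p + binent (1 - q) q \<le> binent ((1 - p) + (1 - q)) (p + q)"
    using assms by (intro binent_superadditive) auto
  ultimately have "binent (1 - p) p + binent (1 - q) q \<le> binent (2 * (1 - m)) (2 * m)"
    by (simp only:)
  also have "\<dots> = 2 * binent (1 - m) m"
    using m by (intro binent_scale) auto
  finally have "7/10 * (binent (1 - p) p + binent (1 - q) q) \<le> 7/5 * binent (1 - m) m"
    by simp
  also have "\<dots> \<le> binent (1 - r) r"
    using binent_square[OF m] by (simp add: r_def)
  also have "\<dots> \<le> binent (1 - s) s"
  proof (rule binent_mono)
    have "r = 2 * m - m\<^sup>2" by (simp add: r_def power2_eq_square algebra_simps)
    moreover have "m\<^sup>2 \<le> m" using m by (simp add: power2_eq_square mult_left_le)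
    ultimately show "0 \<le> r" "r < 1/2" using m zero_le_power2[of m] by linarith+
    \<comment> \<open>This square is exactly \<open>s - r\<close>.\<close>
    have "0 \<le> ((p - q) / 2)\<^sup>2" by simp
    then show "r \<le> s"
      by (simp add: r_def s_def m_def power2_eq_square algebra_simps)
    have "0 \<le> p * q" using assms by simp
    moreover have "s = p + q - p * q" by (simp add: s_def algebra_simps)
    ultimately have "s \<le> 1/5" using assms by linarith
    then show "s \<le> 1 - r" using \<open>r \<le> s\<close> by simp
  qed
  finally show ?thesis by (simp add: s_def)
qed

section \<open>Weighted pairs and Markov's inequality\<close>

text \<open>Homogeneous form of \<open>h(p + q - p q) \<ge> (1 - p) * h q\<close>, where
  \<open>x = w * (1 - p)\<close> and \<open>x' = w' * (1 - q)\<close>. The second argument splits as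
  \<open>x * (w' - x') + (w - x) * w'\<close>; the last piece, paired with \<open>0\<close>, has no
  entropy.\<close>

lemma binent_prod_ge_left:
  assumes "0 \<le> x" "x \<le> w" "0 \<le> x'" "x' \<le> w'"
  shows "x * binent x' (w' - x') \<le> binent (x * x') (w * w' - x * x')"
proof -
  have "x * binent x' (w' - x') = binent (x * x') (x * (w' - x')) + binent 0 ((w - x) * w')"
    using assms by (simp add: binent_scale)
  also have "\<dots> \<le> binent (x * x' + 0) (x * (w' - x') + (w - x) * w')"
    using assms by (intro binent_superadditive) auto
  finally show ?thesis by (simp add: algebra_simps)
qed

text \<open>The preceding bound for \<open>p, q \<le> 1/10\<close>, scaled by
  \<open>w * w'\<close>.\<close>

lemma binent_prod:
  assumes "0 \<le> x" "x \<le> w" "0 \<le> x'" "x' \<le> w'" "9/10 * w \<le> x" "9/10 * w' \<le> x'"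
  shows "7/10 * (w' * binent x (w - x) + w * binent x' (w' - x'))
    \<le> binent (x * x') (w * w' - x * x')"
proof (cases "w = 0 \<or> w' = 0")
  case True
  with assms show ?thesis by auto
next
  case False
  with assms have w: "w > 0" "w' > 0" by auto
  define p q where "p = 1 - x / w" and "q = 1 - x' / w'"
  have x: "x = w * (1 - p)" "w - x = w * p" "x' = w' * (1 - q)" "w' - x' = w' * q"
    using w by (auto simp: p_def q_def algebra_simps)
  have pq: "0 \<le> p" "p \<le> 1/10" "0 \<le> q" "q \<le> 1/10"
    using w assms by (auto simp: p_def q_def field_simps)
  have 1: "binent x (w - x) = w * binent (1 - p) p" "binent x' (w' - x') = w' * binent (1 - q) q"
    unfolding x(2,4) unfolding x(1,3) using w pq by (auto intro!: binent_scale)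
  have "binent (x * x') (w * w' - x * x')
      = binent ((w * w') * ((1 - p) * (1 - q))) ((w * w') * (1 - (1 - p) * (1 - q)))"
    unfolding x(1,3) by (simp add: algebra_simps)
  also have "\<dots> = (w * w') * binent ((1 - p) * (1 - q)) (1 - (1 - p) * (1 - q))"
    using w pq by (intro binent_scale) (auto simp: mult_le_one)
  finally have 2: "binent (x * x') (w * w' - x * x')
      = (w * w') * binent ((1 - p) * (1 - q)) (1 - (1 - p) * (1 - q))" .
  have "(w * w') * (7/10 * (binent (1 - p) p + binent (1 - q) q))
      \<le> (w * w') * binent ((1 - p) * (1 - q)) (1 - (1 - p) * (1 - q))"
    using binent_or[OF pq] w by (intro mult_left_mono) auto
  then show ?thesis unfolding 1 2 by (simp add: algebra_simps)
qed

text \<open>The inequality for i.i.d. \<open>p\<close> and \<open>q\<close>: index \<open>i\<close>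
  has probability \<open>w i\<close>, and \<open>x i\<close> is the part of it in which the newly
  revealed element is absent.\<close>

lemma sum_binent_prod:
  fixes x w :: "'i \<Rightarrow> real"
  assumes "finite I" and xw: "\<And>i. i \<in> I \<Longrightarrow> 0 \<le> x i \<and> x i \<le> w i"
    and "sum w I = 1" and "(\<Sum>i\<in>I. w i - x i) \<le> 1/100"
  shows "63/50 * (\<Sum>i\<in>I. binent (x i) (w i - x i))
    \<le> (\<Sum>i\<in>I. \<Sum>j\<in>I. binent (x i * x j) (w i * w j - x i * x j))"
proof -
  \<comment> \<open>\<open>c\<close> keeps the weight of the indices with conditional probability at
    most \<open>1/10\<close> and drops the others.\<close>
  define c where "c i = (if 9/10 * w i \<le> x i then w i else 0)" for i
  define e where "e i = binent (x i) (w i - x i)" for i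
  have e: "e i \<ge> 0" if "i \<in> I" for i
    using xw[OF that] by (auto simp: e_def intro: binent_nonneg)
  \<comment> \<open>If both indices are kept, this is the two-sided bound. If one is kept, the
    one-sided bound gives even \<open>9/10\<close>. If none is, the left side vanishes.\<close>
  have pair: "7/10 * (c j * e i + c i * e j) \<le> binent (x i * x j) (w i * w j - x i * x j)"
    if i: "i \<in> I" and j: "j \<in> I" for i j
  proof -
    note bounds = xw[OF i] xw[OF j] e[OF i] e[OF j]
    have left: "x i * e j \<le> binent (x i * x j) (w i * w j - x i * x j)"
      using bounds binent_prod_ge_left[of "x i" "w i" "x j" "w j"] by (simp add: e_def)
    have right: "x j * e i \<le> binent (x i * x j) (w i * w j - x i * x j)"
      using bounds binent_prod_ge_left[of "x j" "w j" "x i" "w i"] by (simp add: e_def mult.commute)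
    have both: "7/10 * (w j * e i + w i * e j) \<le> binent (x i * x j) (w i * w j - x i * x j)"
      if "9/10 * w i \<le> x i" "9/10 * w j \<le> x j"
      using bounds that binent_prod[of "x i" "w i" "x j" "w j"] by (simp add: e_def)
    have nonneg: "0 \<le> x i * e j" "0 \<le> w i * e j" "0 \<le> w j * e i"
      using bounds by auto
    have "9/10 * w i * e j \<le> x i * e j" if "9/10 * w i \<le> x i"
      using that bounds by (intro mult_right_mono) auto
    moreover have "9/10 * w j * e i \<le> x j * e i" if "9/10 * w j \<le> x j"
      using that bounds by (intro mult_right_mono) auto
    ultimately show ?thesis
      using left right both nonneg by (auto simp: c_def)
  qed
  have "9/10 \<le> sum c I"
  proof -
    \<comment> \<open>Markov's inequality: a dropped index has \<open>w i - x i > w i / 10\<close>,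
      so the dropped weight is at most \<open>10 * 1/100\<close>.\<close>
    have "(\<Sum>i\<in>I. 1/10 * (w i - c i)) \<le> (\<Sum>i\<in>I. w i - x i)"
      using xw by (intro sum_mono) (force simp: c_def)
    then show ?thesis
      using assms by (simp add: sum_subtractf flip: sum_divide_distrib sum_distrib_left)
  qed
  then have "63/50 * sum e I \<le> 7/5 * sum c I * sum e I"
    using e by (intro mult_right_mono sum_nonneg) auto
  also have "\<dots> = (\<Sum>i\<in>I. \<Sum>j\<in>I. 7/10 * (c j * e i + c i * e j))"
  proof -
    have "(\<Sum>i\<in>I. \<Sum>j\<in>I. c j * e i) = sum c I * sum e I"
      "(\<Sum>i\<in>I. \<Sum>j\<in>I. c i * e j) = sum c I * sum e I"
      by (simp_all flip: sum_distrib_left sum_distrib_right)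
    then show ?thesis
      unfolding sum_distrib_left[symmetric] sum.distrib by simp
  qed
  also have "\<dots> \<le> (\<Sum>i\<in>I. \<Sum>j\<in>I. binent (x i * x j) (w i * w j - x i * x j))"
    by (intro sum_mono pair)
  finally show ?thesis by (simp add: e_def)
qed

section \<open>Laws of unions and the chain rule\<close>

lemma sum_Pow_insert:
  assumes "finite F" "a \<notin> F"
  shows "sum f (Pow (insert a F)) = (\<Sum>S\<in>Pow F. f S + f (insert a S))"
proof -
  have "inj_on (insert a) (Pow F)" using assms by (auto simp: inj_on_def)
  moreover have "Pow F \<inter> insert a ` Pow F = {}" using assms by auto
  ultimately show ?thesis
    using assms by (simp add: Pow_insert sum.union_disjoint sum.reindex sum.distrib)
qed

text \<open>The weights need not sum to 1: the induction also applies this to the part of a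
  distribution living on sets that avoid one element.\<close>

definition union_law :: "'a set \<Rightarrow> ('a set \<Rightarrow> real) \<Rightarrow> 'a set \<Rightarrow> real" where
  "union_law F \<mu> T = (\<Sum>S\<in>Pow F. \<Sum>S'\<in>Pow F. if S \<union> S' = T then \<mu> S * \<mu> S' else 0)"

text \<open>A union avoids \<open>a\<close> exactly when both sets do. Forgetting \<open>a\<close>
  turns \<open>\<mu>\<close> into \<open>\<mu>'\<close>, so unions with trace \<open>T\<close> on
  \<open>F\<close> have total weight \<open>union_law F \<mu>' T\<close>; subtracting those without
  \<open>a\<close> leaves those with \<open>a\<close>.\<close>

lemma union_law_insert:
  fixes \<mu> :: "'a set \<Rightarrow> real"
  assumes "finite F" "a \<notin> F" "T \<subseteq> F"
  defines "\<mu>' \<equiv> (\<lambda>S. \<mu> S + \<mu> (insert a S))"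
  shows "union_law (insert a F) \<mu> T = union_law F \<mu> T"
    and "union_law (insert a F) \<mu> (insert a T) = union_law F \<mu>' T - union_law F \<mu> T"
proof -
  have ne: "insert a X \<noteq> T" for X using assms by auto
  have eq: "insert a (S \<union> S') = insert a T \<longleftrightarrow> S \<union> S' = T" if "S \<in> Pow F" "S' \<in> Pow F" for S S'
    using that assms by (intro insert_ident) auto
  have ne': "S \<union> S' \<noteq> insert a T" if "S \<in> Pow F" "S' \<in> Pow F" for S S'
    using that assms by auto
  show "union_law (insert a F) \<mu> T = union_law F \<mu> T"
    using assms by (simp add: union_law_def sum_Pow_insert ne)
  have "union_law (insert a F) \<mu> (insert a T) =
     (\<Sum>S\<in>Pow F. \<Sum>S'\<in>Pow F. if S \<union> S' = T then \<mu>' S * \<mu>' S' - \<mu> S * \<mu> S' else 0)"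
    unfolding union_law_def sum_Pow_insert[OF assms(1,2)] sum.distrib[symmetric]
    by (intro sum.cong refl) (simp add: eq ne' \<mu>'_def algebra_simps)
  also have "\<dots> = union_law F \<mu>' T - union_law F \<mu> T"
    unfolding union_law_def sum_subtractf[symmetric] by (intro sum.cong) auto
  finally show "union_law (insert a F) \<mu> (insert a T) = union_law F \<mu>' T - union_law F \<mu> T" .
qed

text \<open>Conditioning on the pair \<open>(S, S')\<close> leaves no more entropy than conditioning
  on \<open>S \<union> S'\<close> alone. Here this is superadditivity of \<open>binent\<close> over
  the pairs with a common union.\<close>

lemma binent_union_law:
  assumes "finite F" and xw: "\<And>S. S \<in> Pow F \<Longrightarrow> 0 \<le> x S \<and> x S \<le> w S"
  shows "(\<Sum>S\<in>Pow F. \<Sum>S'\<in>Pow F. binent (x S * x S') (w S * w S' - x S * x S'))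
    \<le> (\<Sum>T\<in>Pow F. binent (union_law F x T) (union_law F w T - union_law F x T))"
proof -
  let ?P = "Pow F \<times> Pow F"
  let ?b = "\<lambda>(S, S'). binent (x S * x S') (w S * w S' - x S * x S')"
  define R where "R T = {z \<in> ?P. fst z \<union> snd z = T}" for T
  have fin: "finite ?P" using assms by simp
  have law: "union_law F f T = (\<Sum>(S, S')\<in>R T. f S * f S')" for f T
  proof -
    have "union_law F f T = (\<Sum>z\<in>?P. if fst z \<union> snd z = T then f (fst z) * f (snd z) else 0)"
      by (simp add: union_law_def sum.cartesian_product case_prod_beta)
    also have "\<dots> = (\<Sum>(S, S')\<in>R T. f S * f S')"
      using fin by (simp add: R_def sum.inter_filter case_prod_beta)
    finally show ?thesis .
  qed
  have "(\<Sum>S\<in>Pow F. \<Sum>S'\<in>Pow F. binent (x S * x S') (w S * w S' - x S * x S')) = sum ?b ?P"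
    by (simp add: sum.cartesian_product)
  also have "\<dots> = (\<Sum>T\<in>Pow F. sum ?b (R T))"
    unfolding R_def using fin assms by (intro sum.group[symmetric]) auto
  also have "\<dots> \<le> (\<Sum>T\<in>Pow F. binent (union_law F x T) (union_law F w T - union_law F x T))"
  proof (rule sum_mono)
    fix T
    have "sum ?b (R T) = (\<Sum>z\<in>R T. binent (x (fst z) * x (snd z))
        (w (fst z) * w (snd z) - x (fst z) * x (snd z)))"
      by (simp add: case_prod_beta)
    also have "\<dots> \<le> binent (\<Sum>z\<in>R T. x (fst z) * x (snd z))
        (\<Sum>z\<in>R T. w (fst z) * w (snd z) - x (fst z) * x (snd z))"
    proof (rule binent_sum)
      fix z assume "z \<in> R T"
      then have "fst z \<in> Pow F" "snd z \<in> Pow F" by (auto simp: R_def)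
      note bounds = xw[OF this(1)] xw[OF this(2)]
      then show "0 \<le> x (fst z) * x (snd z)" by simp
      have "x (fst z) * x (snd z) \<le> w (fst z) * w (snd z)"
        using bounds by (intro mult_mono) auto
      then show "0 \<le> w (fst z) * w (snd z) - x (fst z) * x (snd z)" by simp
    qed
    finally show "sum ?b (R T) \<le> binent (union_law F x T) (union_law F w T - union_law F x T)"
      by (simp add: law sum_subtractf case_prod_beta)
  qed
  finally show ?thesis .
qed

text \<open>Induction on the ground set. The chain rule splits both entropies into that of the trace
  on \<open>F\<close>, covered by the induction hypothesis, and the conditional entropy of the
  membership of \<open>a\<close>, covered by the inequality for weighted pairs.\<close>

lemma sum_eta_union_law:
  assumes "finite F" "\<And>S. S \<in> Pow F \<Longrightarrow> \<mu> S \<ge> 0" "sum \<mu> (Pow F) = 1"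
    "\<And>i. i \<in> F \<Longrightarrow> sum \<mu> {S \<in> Pow F. i \<in> S} \<le> 1/100"
  shows "63/50 * (\<Sum>S\<in>Pow F. eta (\<mu> S)) \<le> (\<Sum>T\<in>Pow F. eta (union_law F \<mu> T))"
  using assms
proof (induction F arbitrary: \<mu> rule: finite_induct)
  case empty
  then show ?case by (simp add: union_law_def)
next
  case (insert a F)
  note sum_ins = sum_Pow_insert[OF insert.hyps]
  \<comment> \<open>This is the law of the random set with \<open>a\<close> removed; the marginals
    of the other elements are unchanged.\<close>
  define \<mu>' where "\<mu>' S = \<mu> S + \<mu> (insert a S)" for S
  have nonneg: "\<mu> S \<ge> 0" "\<mu> (insert a S) \<ge> 0" if "S \<in> Pow F" for S
    using insert.prems(1)[of S] insert.prems(1)[of "insert a S"] that by auto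
  have marg: "(\<Sum>S\<in>Pow (insert a F). if i \<in> S then \<mu> S else 0) \<le> 1/100" if "i \<in> insert a F" for i
    using insert.prems(3)[OF that] insert.hyps by (subst sum.inter_filter[symmetric]) auto
  have total: "sum \<mu>' (Pow F) = 1"
    using insert.prems(2) unfolding sum_ins by (simp add: \<mu>'_def)
  have IH: "63/50 * (\<Sum>S\<in>Pow F. eta (\<mu>' S)) \<le> (\<Sum>T\<in>Pow F. eta (union_law F \<mu>' T))"
  proof (rule insert.IH)
    fix i assume i: "i \<in> F"
    then have "i \<noteq> a" using insert.hyps by auto
    have "sum \<mu>' {S \<in> Pow F. i \<in> S} = (\<Sum>S\<in>Pow F. if i \<in> S then \<mu>' S else 0)"
      using insert.hyps by (intro sum.inter_filter) simp
    also have "\<dots> = (\<Sum>S\<in>Pow (insert a F). if i \<in> S then \<mu> S else 0)"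
      unfolding sum_ins using \<open>i \<noteq> a\<close> by (intro sum.cong) (auto simp: \<mu>'_def)
    finally show "sum \<mu>' {S \<in> Pow F. i \<in> S} \<le> 1/100" using marg[of i] i by simp
  qed (use nonneg total in \<open>auto simp: \<mu>'_def\<close>)
  have diff: "\<mu>' S - \<mu> S = \<mu> (insert a S)" for S by (simp add: \<mu>'_def)
  have le: "0 \<le> \<mu> S \<and> \<mu> S \<le> \<mu>' S" if "S \<in> Pow F" for S
    using nonneg[OF that] by (simp add: \<mu>'_def)
  \<comment> \<open>The sum is the probability that \<open>a\<close> belongs to the random
    set.\<close>
  have "(\<Sum>S\<in>Pow F. \<mu>' S - \<mu> S) \<le> 1/100"
  proof -
    have "(\<Sum>S\<in>Pow F. \<mu>' S - \<mu> S) = (\<Sum>S\<in>Pow (insert a F). if a \<in> S then \<mu> S else 0)"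
      unfolding sum_ins diff using insert.hyps by (intro sum.cong) auto
    then show ?thesis using marg[of a] by simp
  qed
  then have "63/50 * (\<Sum>S\<in>Pow F. binent (\<mu> S) (\<mu>' S - \<mu> S))
      \<le> (\<Sum>S\<in>Pow F. \<Sum>S'\<in>Pow F. binent (\<mu> S * \<mu> S') (\<mu>' S * \<mu>' S' - \<mu> S * \<mu> S'))"
    using insert.hyps le total by (intro sum_binent_prod) auto
  also have "\<dots> \<le> (\<Sum>T\<in>Pow F. binent (union_law F \<mu> T) (union_law F \<mu>' T - union_law F \<mu> T))"
    using insert.hyps le by (intro binent_union_law) auto
  finally have step: "63/50 * (\<Sum>S\<in>Pow F. binent (\<mu> S) (\<mu>' S - \<mu> S))
      \<le> (\<Sum>T\<in>Pow F. binent (union_law F \<mu> T) (union_law F \<mu>' T - union_law F \<mu> T))" .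
  \<comment> \<open>The chain rule, first for one sample and then for the union.\<close>
  have "(\<Sum>S\<in>Pow (insert a F). eta (\<mu> S))
      = (\<Sum>S\<in>Pow F. eta (\<mu>' S)) + (\<Sum>S\<in>Pow F. binent (\<mu> S) (\<mu>' S - \<mu> S))"
    unfolding sum_ins sum.distrib[symmetric] by (simp add: binent_def \<mu>'_def)
  moreover have "(\<Sum>T\<in>Pow (insert a F). eta (union_law (insert a F) \<mu> T))
      = (\<Sum>T\<in>Pow F. eta (union_law F \<mu>' T))
        + (\<Sum>T\<in>Pow F. binent (union_law F \<mu> T) (union_law F \<mu>' T - union_law F \<mu> T))"
    unfolding sum_ins sum.distrib[symmetric]
    using insert.hyps
    by (intro sum.cong) (auto simp: union_law_insert binent_def \<mu>'_def[abs_def])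
  ultimately show ?case using IH step by simp
qed

section \<open>Transfer to random sets\<close>

lemma entropy_eq_sum_eta:
  assumes "prob_space M" "finite S" "X \<in> M \<rightarrow>\<^sub>M count_space S"
  shows "prob_space.entropy M 2 (count_space S) X
    = (\<Sum>s\<in>S. eta (measure M {\<omega> \<in> space M. X \<omega> = s})) / ln 2"
  unfolding entropy_count_space_finite[OF assms]
  by (simp add: eta_def log_def sum_negf sum_divide_distrib)

theorem theorem1:
  fixes n :: nat and M :: "'w measure" and A B :: "'w \<Rightarrow> nat set"
  assumes "n \<ge> 1"
    and "prob_space M"
    and "prob_space.indep_var M (count_space (Pow {1..n})) A (count_space (Pow {1..n})) B"
    and "distr M (count_space (Pow {1..n})) A = distr M (count_space (Pow {1..n})) B"
    and "\<forall>i\<in>{1..n}. measure M {\<omega> \<in> space M. i \<in> A \<omega>} \<le> 0.01"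
  shows "prob_space.entropy M 2 (count_space (Pow {1..n})) (\<lambda>\<omega>. A \<omega> \<union> B \<omega>)
    \<ge> 1.26 * prob_space.entropy M 2 (count_space (Pow {1..n})) A"
proof -
  interpret prob_space M by fact
  let ?P = "Pow {1..n}"
  let ?N = "count_space ?P"
  define \<mu> where "\<mu> S = prob {\<omega> \<in> space M. A \<omega> = S}" for S
  have A: "A \<in> M \<rightarrow>\<^sub>M ?N" and B: "B \<in> M \<rightarrow>\<^sub>M ?N"
    using indep_var_rv1[OF assms(3)] indep_var_rv2[OF assms(3)] .
  have A_in: "A \<omega> \<in> ?P" and B_in: "B \<omega> \<in> ?P" if "\<omega> \<in> space M" for \<omega>
    using measurable_space[OF A that] measurable_space[OF B that] by auto
  have pre: "{\<omega> \<in> space M. X \<omega> = S} = X -` {S} \<inter> space M" for X :: "'w \<Rightarrow> nat set" and S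
    by auto
  have ev_A: "{\<omega> \<in> space M. A \<omega> = S} \<in> events" and ev_B: "{\<omega> \<in> space M. B \<omega> = S} \<in> events"
    if "S \<in> ?P" for S
    unfolding pre using that measurable_sets[OF A] measurable_sets[OF B] by auto
  have B_law: "prob {\<omega> \<in> space M. B \<omega> = S} = \<mu> S" if "S \<in> ?P" for S
    using that A B arg_cong[OF assms(4), of "\<lambda>D. measure D {S}"]
    unfolding \<mu>_def pre by (simp add: measure_distr)
  have joint_eq: "{\<omega> \<in> space M. A \<omega> = S \<and> B \<omega> = S'}
      = {\<omega> \<in> space M. A \<omega> = S} \<inter> {\<omega> \<in> space M. B \<omega> = S'}" for S S'
    by auto
  have joint: "prob {\<omega> \<in> space M. A \<omega> = S \<and> B \<omega> = S'} = \<mu> S * \<mu> S'"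
    if "S \<in> ?P" "S' \<in> ?P" for S S'
  proof -
    have "prob ((\<lambda>\<omega>. (A \<omega>, B \<omega>)) -` ({S} \<times> {S'}) \<inter> space M)
        = prob (A -` {S} \<inter> space M) * prob (B -` {S'} \<inter> space M)"
      using that by (intro indep_varD[OF assms(3)]) auto
    moreover have "(\<lambda>\<omega>. (A \<omega>, B \<omega>)) -` ({S} \<times> {S'}) \<inter> space M
        = {\<omega> \<in> space M. A \<omega> = S \<and> B \<omega> = S'}"
      by auto
    ultimately show ?thesis
      using B_law[OF that(2)] by (simp add: \<mu>_def pre)
  qed
  have A_sum: "prob {\<omega> \<in> space M. A \<omega> \<in> Q} = sum \<mu> Q" if "Q \<subseteq> ?P" for Q
  proof -
    have "finite Q" using that finite_subset by blast
    have "{\<omega> \<in> space M. A \<omega> \<in> Q} = (\<Union>S\<in>Q. {\<omega> \<in> space M. A \<omega> = S})" by auto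
    then show ?thesis
      using that ev_A \<open>finite Q\<close> unfolding \<mu>_def
      by (auto simp: disjoint_family_on_def intro!: finite_measure_finite_Union)
  qed
  \<comment> \<open>As \<open>A\<close> takes only finitely many values, it suffices to fix its
    value \<open>S\<close>.\<close>
  have AB: "(\<lambda>\<omega>. A \<omega> \<union> B \<omega>) \<in> M \<rightarrow>\<^sub>M ?N"
  proof (rule measurable_compose_countable'[OF _ A])
    fix S assume "S \<in> ?P"
    then show "(\<lambda>\<omega>. S \<union> B \<omega>) \<in> M \<rightarrow>\<^sub>M ?N"
      by (intro measurable_compose[OF B]) auto
  qed (simp add: countable_finite)
  \<comment> \<open>The event is a disjoint union over the pairs of values with union
    \<open>T\<close>, and independence factors the probability of each pair.\<close>
  have AB_law: "prob {\<omega> \<in> space M. A \<omega> \<union> B \<omega> = T} = union_law {1..n} \<mu> T" for T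
  proof -
    let ?R = "{z \<in> ?P \<times> ?P. fst z \<union> snd z = T}"
    let ?E = "\<lambda>z. {\<omega> \<in> space M. A \<omega> = fst z \<and> B \<omega> = snd z}"
    have "{\<omega> \<in> space M. A \<omega> \<union> B \<omega> = T} = (\<Union>z\<in>?R. ?E z)"
      using A_in B_in by fastforce
    also have "prob \<dots> = (\<Sum>z\<in>?R. prob (?E z))"
      using ev_A ev_B
      by (intro finite_measure_finite_Union)
        (auto simp: disjoint_family_on_def joint_eq intro!: sets.Int)
    also have "\<dots> = (\<Sum>z\<in>?R. \<mu> (fst z) * \<mu> (snd z))"
      using joint by (intro sum.cong) auto
    also have "\<dots> = union_law {1..n} \<mu> T"
      by (simp add: union_law_def sum.inter_filter sum.cartesian_product case_prod_beta)
    finally show ?thesis .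
  qed
  have "63/50 * (\<Sum>S\<in>?P. eta (\<mu> S)) \<le> (\<Sum>T\<in>?P. eta (union_law {1..n} \<mu> T))"
  proof (rule sum_eta_union_law)
    have "{\<omega> \<in> space M. A \<omega> \<in> ?P} = space M" using A_in by auto
    then show "sum \<mu> ?P = 1" using A_sum[of ?P] prob_space by simp
    fix i assume i: "i \<in> {1..n}"
    have "{\<omega> \<in> space M. A \<omega> \<in> {S \<in> ?P. i \<in> S}} = {\<omega> \<in> space M. i \<in> A \<omega>}"
      using A_in by auto
    then have "sum \<mu> {S \<in> ?P. i \<in> S} = prob {\<omega> \<in> space M. i \<in> A \<omega>}"
      by (subst A_sum[symmetric]) (simp_all only: Collect_subset)
    then show "sum \<mu> {S \<in> ?P. i \<in> S} \<le> 1/100"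
      using bspec[OF assms(5) i] by simp
  qed (auto simp: \<mu>_def)
  \<comment> \<open>Division by \<open>ln 2\<close> converts nats to bits.\<close>
  then have "63/50 * (\<Sum>S\<in>?P. eta (\<mu> S)) / ln 2 \<le> (\<Sum>T\<in>?P. eta (union_law {1..n} \<mu> T)) / ln 2"
    by (intro divide_right_mono) auto
  then show ?thesis
    using entropy_eq_sum_eta[OF assms(2) _ A] entropy_eq_sum_eta[OF assms(2) _ AB]
    by (simp add: AB_law \<mu>_def)
qed

end
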